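(* Let $P$ and $Q$ be two image-finite process expressions. Then $P$ and $Q$ are stateless bisimilar if and only if for all valuations $V\in\mathcal{V}$ and all $\mathrm{HML}^{check+set}$ formulas $\phi$ we have $\langle P,V\rangle\in[\![\phi]\!]\Leftrightarrow\langle Q,V\rangle\in[\![\phi]\!]$.
   Context: **Process algebra with global variables.** Fix a data domain $D$, a finite set $Var$ of global variable names, a set $Act$ of actions, and a set $PN$ of process names. The transition labels are $TL = Act\cup\{assign(v,d)\mid v\in Var, d\in D\}$ (with $assign(v,d)$ formal labels). Process expressions (the set $\mathcal{P}$) are generated by $$P ::= \lambda.P \mid \delta \mid P+P \mid P\|P \mid \partial_B(P) \mid X \mid (v=d)\to P,$$ with $\lambda\in TL$, $B\subseteq Act$, $X\in PN$, $v\in Var$, $d\in D$. A recursive specification is fixed, containing exactly one equation $X\stackrel{\mathrm{def}}{=}t$ with $t\in\mathcal{P}$ for every $X\in PN$; it is guarded: in each equation $X\stackrel{\mathrm{def}}{=}t$ every occurrence of $X$ in $t$ is in the scope of an action prefix. A partial, commutative and associative function $\gamma:Act\times Act\rightharpoonup Act$ is fixed, such that if $\gamma(a,b)=c$ then $\gamma(c,d)$ is undefined for every $d$. A valuation is a function $V:Var\to D$; $\mathcal{V}$ is the set of valuations, and $V[v\mapsto d]$ is $V$ updated to map $v$ to $d$. States are pairs $\langle P,V\rangle\in\mathcal{P}\times\mathcal{V}$. The transition relation is the least relation closed under (with $a,b,c\in Act$, $\lambda\in TL$): - $\langle a.P,V\rangle\xrightarrow{a}\langle P,V\rangle$; $\langle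 assign(v,d).P,V\rangle\xrightarrow{assign(v,d)}\langle P,V[v\mapsto d]\rangle$; - if $\langle P,V\rangle\xrightarrow{\lambda}\langle P',V'\rangle$ then: $\langle (v=d)\to P,V\rangle\xrightarrow{\lambda}\langle P',V'\rangle$ provided $V(v)=d$; $\langle X,V\rangle\xrightarrow{\lambda}\langle P',V'\rangle$ provided $X\stackrel{\mathrm{def}}{=}P$; $\langle P+Q,V\rangle\xrightarrow{\lambda}\langle P',V'\rangle$ and $\langle Q+P,V\rangle\xrightarrow{\lambda}\langle P',V'\rangle$; $\langle P\|Q,V\rangle\xrightarrow{\lambda}\langle P'\|Q,V'\rangle$ and $\langle Q\|P,V\rangle\xrightarrow{\lambda}\langle Q\|P',V'\rangle$; $\langle\partial_B(P),V\rangle\xrightarrow{\lambda}\langle\partial_B(P'),V'\rangle$ provided $\lambda\notin B$; - if $\langle P,V\rangle\xrightarrow{a}\langle P',V\rangle$, $\langle Q,V\rangle\xrightarrow{b}\langle Q',V\rangle$ and $\gamma(a,b)=c$, then $\langle P\|Q,V\rangle\xrightarrow{c}\langle P'\|Q',V\rangle$. **Stateless bisimilarity.** $R\subseteq\mathcal{P}\times\mathcal{P}$ is a stateless bisimulation if $(P,Q)\in R$ implies, for all $\lambda\in TL$ and $V,V'\in\mathcal{V}$: whenever $\langle P,V\rangle\xrightarrow{\lambda}\langle P',V'\rangle$ there is $Q'$ with $\langle Q,V\rangle\xrightarrow{\lambda}\langle Q',V'\rangle$ and $(P',Q')\in R$; and whenever $\langle Q,V\rangle\xrightarrow{\lambda}\langle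 Q',V'\rangle$ there is $P'$ with $\langle P,V\rangle\xrightarrow{\lambda}\langle P',V'\rangle$ and $(P',Q')\in R$. $P$ and $Q$ are stateless bisimilar if some stateless bisimulation contains $(P,Q)$. **Image-finiteness.** $P'$ is reachable from $P$ if there are $n\ge 0$, expressions $P=P_0,\dots,P_n=P'$ and labels $\lambda_1,\dots,\lambda_n$ such that for each $i$ there exist valuations $V,V'$ (chosen independently for each $i$) with $\langle P_{i-1},V\rangle\xrightarrow{\lambda_i}\langle P_i,V'\rangle$. A state $\langle P,V\rangle$ is image-finite if for every label $\lambda$ the set $\{\langle P',V'\rangle\mid\langle P,V\rangle\xrightarrow{\lambda}\langle P',V'\rangle\}$ is finite. A process expression $P$ is image-finite if for every $P'$ reachable from $P$ and every valuation $V$ the state $\langle P',V\rangle$ is image-finite. **Logic $\mathrm{HML}^{check+set}$.** Formulas: $$\phi ::= true\mid false\mid (v=e)\mid\neg\phi\mid\phi\wedge\phi\mid\phi\vee\phi\mid\langle T\rangle\phi\mid[T]\phi\mid\ \downarrow(v:=e)\phi,$$ with $T$ a nonempty finite subset of $TL$, $v\in Var$, $e\in D$. With $S=\mathcal{P}\times\mathcal{V}$, the interpretation $[\![\phi]\!]\subseteq S$ is: $[\![true]\!]=S$, $[\![false]\!]=\emptyset$, $[\![v=e]\!]=\{\langle P,V\rangle\mid V(v)=e\}$; $\neg,\wedge,\vee$ are complement, intersection, union; $[\![\langle T\rangle\phi]\!]=\{u\mid\exists u'\in[\![\phi]\!],\lambda\in T: u\xrightarrow{\lambda}u'\}$; $[\![[T]\phi]\!]=\{u\mid\forall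 u'\in S,\lambda\in T: u\xrightarrow{\lambda}u'\Rightarrow u'\in[\![\phi]\!]\}$; $[\![\downarrow(v:=e)\phi]\!]=\{\langle P,V\rangle\mid\langle P,V[v\mapsto e]\rangle\in[\![\phi]\!]\}$. *)

theory Defs
  imports Main
begin

text \<open>
  Type parameters: \<open>'a\<close> actions, \<open>'v\<close> global variables, \<open>'d\<close> data domain, \<open>'x\<close> process names.
\<close>

datatype ('a, 'v, 'd) tlabel = Act 'a | Assign 'v 'd

datatype ('a, 'v, 'd, 'x) proc =
    Prefix "('a, 'v, 'd) tlabel" "('a, 'v, 'd, 'x) proc"
  | Deadlock
  | Choice "('a, 'v, 'd, 'x) proc" "('a, 'v, 'd, 'x) proc"
  | Par "('a, 'v, 'd, 'x) proc" "('a, 'v, 'd, 'x) proc"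
  | Encap "'a set" "('a, 'v, 'd, 'x) proc"
  | Name 'x
  | Guard 'v 'd "('a, 'v, 'd, 'x) proc"

type_synonym ('v, 'd) valuation = "'v \<Rightarrow> 'd"

type_synonym ('a, 'v, 'd, 'x) state = "('a, 'v, 'd, 'x) proc \<times> ('v, 'd) valuation"

text \<open>A recursive specification maps each name to the right-hand side of its unique equation.\<close>

type_synonym ('a, 'v, 'd, 'x) spec = "'x \<Rightarrow> ('a, 'v, 'd, 'x) proc"

text \<open>
  \<open>unguarded_names P\<close> are the names with an occurrence in \<open>P\<close> that is not in the scope of a prefix.
  Guardedness is required of the occurrences of \<open>X\<close> in its own equation only, and an assignment
  prefix counts as a guard; all stricter notions of guardedness imply this one.
\<close>

primrec unguarded_names :: "('a, 'v, 'd, 'x) proc \<Rightarrow> 'x set" where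
  "unguarded_names (Prefix l P) = {}"
| "unguarded_names Deadlock = {}"
| "unguarded_names (Choice P Q) = unguarded_names P \<union> unguarded_names Q"
| "unguarded_names (Par P Q) = unguarded_names P \<union> unguarded_names Q"
| "unguarded_names (Encap B P) = unguarded_names P"
| "unguarded_names (Name X) = {X}"
| "unguarded_names (Guard v d P) = unguarded_names P"

definition guarded_spec :: "('a, 'v, 'd, 'x) spec \<Rightarrow> bool" where
  "guarded_spec E \<longleftrightarrow> (\<forall>X. X \<notin> unguarded_names (E X))"

text \<open>
  Associativity is strong: both sides are undefined, or both are defined and equal.
  The last conjunct is the handshaking condition.
\<close>

definition comm_function :: "('a \<Rightarrow> 'a \<Rightarrow> 'a option) \<Rightarrow> bool" where
  "comm_function \<gamma> \<longleftrightarrow>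
     (\<forall>a b. \<gamma> a b = \<gamma> b a) \<and>
     (\<forall>a b c. Option.bind (\<gamma> a b) (\<lambda>x. \<gamma> x c) = Option.bind (\<gamma> b c) (\<lambda>y. \<gamma> a y)) \<and>
     (\<forall>a b c d. \<gamma> a b = Some c \<longrightarrow> \<gamma> c d = None)"

inductive step ::
  "('a \<Rightarrow> 'a \<Rightarrow> 'a option) \<Rightarrow> ('a, 'v, 'd, 'x) spec \<Rightarrow>
   ('a, 'v, 'd, 'x) state \<Rightarrow> ('a, 'v, 'd) tlabel \<Rightarrow> ('a, 'v, 'd, 'x) state \<Rightarrow> bool"
  for \<gamma> :: "'a \<Rightarrow> 'a \<Rightarrow> 'a option" and E :: "('a, 'v, 'd, 'x) spec" where
  step_act: "step \<gamma> E (Prefix (Act a) P, V) (Act a) (P, V)"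
| step_assign: "step \<gamma> E (Prefix (Assign v d) P, V) (Assign v d) (P, V(v := d))"
| step_guard: "step \<gamma> E (P, V) l (P', V') \<Longrightarrow> V v = d \<Longrightarrow> step \<gamma> E (Guard v d P, V) l (P', V')"
| step_name: "step \<gamma> E (E X, V) l (P', V') \<Longrightarrow> step \<gamma> E (Name X, V) l (P', V')"
| step_choice1: "step \<gamma> E (P, V) l (P', V') \<Longrightarrow> step \<gamma> E (Choice P Q, V) l (P', V')"
| step_choice2: "step \<gamma> E (P, V) l (P', V') \<Longrightarrow> step \<gamma> E (Choice Q P, V) l (P', V')"
| step_par1: "step \<gamma> E (P, V) l (P', V') \<Longrightarrow> step \<gamma> E (Par P Q, V) l (Par P' Q, V')"
| step_par2: "step \<gamma> E (P, V) l (P', V') \<Longrightarrow> step \<gamma> E (Par Q P, V) l (Par Q P', V')"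
| step_encap: "step \<gamma> E (P, V) l (P', V') \<Longrightarrow> l \<notin> Act ` B \<Longrightarrow>
    step \<gamma> E (Encap B P, V) l (Encap B P', V')"
| step_comm: "step \<gamma> E (P, V) (Act a) (P', V) \<Longrightarrow> step \<gamma> E (Q, V) (Act b) (Q', V) \<Longrightarrow>
    \<gamma> a b = Some c \<Longrightarrow> step \<gamma> E (Par P Q, V) (Act c) (Par P' Q', V)"

definition stateless_bisimulation ::
  "('a \<Rightarrow> 'a \<Rightarrow> 'a option) \<Rightarrow> ('a, 'v, 'd, 'x) spec \<Rightarrow> ('a, 'v, 'd, 'x) proc rel \<Rightarrow> bool" where
  "stateless_bisimulation \<gamma> E R \<longleftrightarrow>
     (\<forall>P Q. (P, Q) \<in> R \<longrightarrow>
        (\<forall>l V V'.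
           (\<forall>P'. step \<gamma> E (P, V) l (P', V') \<longrightarrow>
              (\<exists>Q'. step \<gamma> E (Q, V) l (Q', V') \<and> (P', Q') \<in> R)) \<and>
           (\<forall>Q'. step \<gamma> E (Q, V) l (Q', V') \<longrightarrow>
              (\<exists>P'. step \<gamma> E (P, V) l (P', V') \<and> (P', Q') \<in> R))))"

definition stateless_bisimilar ::
  "('a \<Rightarrow> 'a \<Rightarrow> 'a option) \<Rightarrow> ('a, 'v, 'd, 'x) spec \<Rightarrow>
   ('a, 'v, 'd, 'x) proc \<Rightarrow> ('a, 'v, 'd, 'x) proc \<Rightarrow> bool" where
  "stateless_bisimilar \<gamma> E P Q \<longleftrightarrow> (\<exists>R. stateless_bisimulation \<gamma> E R \<and> (P, Q) \<in> R)"

text \<open>The valuations are chosen afresh in every step of a reachability path.\<close>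

definition reachable ::
  "('a \<Rightarrow> 'a \<Rightarrow> 'a option) \<Rightarrow> ('a, 'v, 'd, 'x) spec \<Rightarrow>
   ('a, 'v, 'd, 'x) proc \<Rightarrow> ('a, 'v, 'd, 'x) proc \<Rightarrow> bool" where
  "reachable \<gamma> E = (\<lambda>P P'. \<exists>l V V'. step \<gamma> E (P, V) l (P', V'))\<^sup>*\<^sup>*"

definition image_finite_state ::
  "('a \<Rightarrow> 'a \<Rightarrow> 'a option) \<Rightarrow> ('a, 'v, 'd, 'x) spec \<Rightarrow> ('a, 'v, 'd, 'x) state \<Rightarrow> bool" where
  "image_finite_state \<gamma> E s \<longleftrightarrow> (\<forall>l. finite {s'. step \<gamma> E s l s'})"

definition image_finite ::
  "('a \<Rightarrow> 'a \<Rightarrow> 'a option) \<Rightarrow> ('a, 'v, 'd, 'x) spec \<Rightarrow> ('a, 'v, 'd, 'x) proc \<Rightarrow> bool" where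
  "image_finite \<gamma> E P \<longleftrightarrow>
     (\<forall>P'. reachable \<gamma> E P P' \<longrightarrow> (\<forall>V. image_finite_state \<gamma> E (P', V)))"

datatype ('a, 'v, 'd) pre_form =
    FTrue
  | FFalse
  | Check 'v 'd
  | Neg "('a, 'v, 'd) pre_form"
  | Conj "('a, 'v, 'd) pre_form" "('a, 'v, 'd) pre_form"
  | Disj "('a, 'v, 'd) pre_form" "('a, 'v, 'd) pre_form"
  | Dia "('a, 'v, 'd) tlabel set" "('a, 'v, 'd) pre_form"
  | Box "('a, 'v, 'd) tlabel set" "('a, 'v, 'd) pre_form"
  | SetVar 'v 'd "('a, 'v, 'd) pre_form"

text \<open>The formulas of the logic are those whose modalities all carry nonempty finite sets.\<close>

inductive_set hml_check_set :: "('a, 'v, 'd) pre_form set" where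
  "FTrue \<in> hml_check_set"
| "FFalse \<in> hml_check_set"
| "Check v e \<in> hml_check_set"
| "\<phi> \<in> hml_check_set \<Longrightarrow> Neg \<phi> \<in> hml_check_set"
| "\<phi> \<in> hml_check_set \<Longrightarrow> \<psi> \<in> hml_check_set \<Longrightarrow> Conj \<phi> \<psi> \<in> hml_check_set"
| "\<phi> \<in> hml_check_set \<Longrightarrow> \<psi> \<in> hml_check_set \<Longrightarrow> Disj \<phi> \<psi> \<in> hml_check_set"
| "finite T \<Longrightarrow> T \<noteq> {} \<Longrightarrow> \<phi> \<in> hml_check_set \<Longrightarrow> Dia T \<phi> \<in> hml_check_set"
| "finite T \<Longrightarrow> T \<noteq> {} \<Longrightarrow> \<phi> \<in> hml_check_set \<Longrightarrow> Box T \<phi> \<in> hml_check_set"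
| "\<phi> \<in> hml_check_set \<Longrightarrow> SetVar v e \<phi> \<in> hml_check_set"

primrec sem ::
  "('a \<Rightarrow> 'a \<Rightarrow> 'a option) \<Rightarrow> ('a, 'v, 'd, 'x) spec \<Rightarrow>
   ('a, 'v, 'd) pre_form \<Rightarrow> ('a, 'v, 'd, 'x) state set" where
  "sem \<gamma> E FTrue = UNIV"
| "sem \<gamma> E FFalse = {}"
| "sem \<gamma> E (Check v e) = {(P, V). V v = e}"
| "sem \<gamma> E (Neg \<phi>) = - sem \<gamma> E \<phi>"
| "sem \<gamma> E (Conj \<phi> \<psi>) = sem \<gamma> E \<phi> \<inter> sem \<gamma> E \<psi>"
| "sem \<gamma> E (Disj \<phi> \<psi>) = sem \<gamma> E \<phi> \<union> sem \<gamma> E \<psi>"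
| "sem \<gamma> E (Dia T \<phi>) = {u. \<exists>u' \<in> sem \<gamma> E \<phi>. \<exists>l \<in> T. step \<gamma> E u l u'}"
| "sem \<gamma> E (Box T \<phi>) = {u. \<forall>u'. \<forall>l \<in> T. step \<gamma> E u l u' \<longrightarrow> u' \<in> sem \<gamma> E \<phi>}"
| "sem \<gamma> E (SetVar v e \<phi>) = {(P, V). (P, V(v := e)) \<in> sem \<gamma> E \<phi>}"

end

theory Submission
  imports Defs
begin

text \<open>
  The set operator overwrites the whole valuation because there are finitely many variables. A
  formula that separates two process expressions under some valuation therefore yields one that
  separates them under every valuation. This lets the Hennessy--Milner argument for image-finite
  expressions survive the change of valuation between steps; the check operator separates
  successors whose valuations differ.
\<close>

text \<open>Induction on the formula, with \<open>V\<close> kept arbitrary: since \<open>R\<close>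
  relates bare expressions, the hypothesis is available at the valuation changed by
  \<open>SetVar\<close>. At the modalities, the answering step ends in the same valuation, so the
  hypothesis applies to the matched successors.\<close>

lemma sem_stateless_bisimulation:
  assumes "stateless_bisimulation \<gamma> E R" and "(P, Q) \<in> R"
  shows "(P, V) \<in> sem \<gamma> E \<phi> \<longleftrightarrow> (Q, V) \<in> sem \<gamma> E \<phi>"
  using assms(2)
proof (induction \<phi> arbitrary: P Q V)
  case (Dia T \<phi>)
  have forward: "\<exists>Q'. step \<gamma> E (Q, V) l (Q', V') \<and> (P', Q') \<in> R"
    if "step \<gamma> E (P, V) l (P', V')" for l P' V'
    using assms(1) Dia.prems that unfolding stateless_bisimulation_def by blast
  have backward: "\<exists>P'. step \<gamma> E (P, V) l (P', V') \<and> (P', Q') \<in> R"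
    if "step \<gamma> E (Q, V) l (Q', V')" for l Q' V'
    using assms(1) Dia.prems that unfolding stateless_bisimulation_def by blast
  show ?case
    using forward backward Dia.IH by (simp add: Bex_def split_paired_Ex) metis
next
  case (Box T \<phi>)
  have forward: "\<exists>Q'. step \<gamma> E (Q, V) l (Q', V') \<and> (P', Q') \<in> R"
    if "step \<gamma> E (P, V) l (P', V')" for l P' V'
    using assms(1) Box.prems that unfolding stateless_bisimulation_def by blast
  have backward: "\<exists>P'. step \<gamma> E (P, V) l (P', V') \<and> (P', Q') \<in> R"
    if "step \<gamma> E (Q, V) l (Q', V')" for l Q' V'
    using assms(1) Box.prems that unfolding stateless_bisimulation_def by blast
  show ?case
    using forward backward Box.IH by (simp add: Ball_def split_paired_All) metis
qed auto

text \<open>Nest one \<open>SetVar\<close> per variable of \<open>A\<close>. The resulting formula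
  depends on \<open>W\<close> but not on \<open>P\<close> or \<open>V\<close>.\<close>

lemma ex_set_vars_formula:
  assumes "finite A" and "\<phi> \<in> hml_check_set"
  shows "\<exists>\<psi> \<in> hml_check_set. \<forall>P V.
    (P, V) \<in> sem \<gamma> E \<psi> \<longleftrightarrow> (P, override_on V W A) \<in> sem \<gamma> E \<phi>"
  using assms(1)
proof (induction A)
  case empty
  then show ?case using assms(2) by auto
next
  case (insert v A)
  then obtain \<psi> where "\<psi> \<in> hml_check_set"
    and "\<forall>P V. (P, V) \<in> sem \<gamma> E \<psi> \<longleftrightarrow> (P, override_on V W A) \<in> sem \<gamma> E \<phi>"
    by blast
  \<comment> \<open>The new \<open>SetVar\<close> is outermost, so it acts on \<open>V\<close>
    before the operators for \<open>A\<close> do.\<close>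
  moreover have "override_on (V(v := W v)) W A = override_on V W (insert v A)" for V
    by (auto simp: override_on_def)
  ultimately show ?case
    by (intro bexI[of _ "SetVar v (W v) \<psi>"]) (auto intro: hml_check_set.intros)
qed

lemma ex_set_valuation_formula:
  fixes W :: "('v::finite, 'd) valuation"
  assumes "\<phi> \<in> hml_check_set"
  shows "\<exists>\<psi> \<in> hml_check_set. \<forall>P V. (P, V) \<in> sem \<gamma> E \<psi> \<longleftrightarrow> (P, W) \<in> sem \<gamma> E \<phi>"
proof -
  have "override_on V W UNIV = W" for V by (auto simp: override_on_def)
  then show ?thesis using ex_set_vars_formula[OF finite_UNIV assms, of \<gamma> E W] by simp
qed

text \<open>This is where image-finiteness pays off: finitely many states to exclude need only a
  finite conjunction.\<close>

lemma ex_separating_conjunction: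
  assumes "finite S"
    and "\<And>s. s \<in> S \<Longrightarrow> \<exists>\<phi> \<in> hml_check_set. u \<in> sem \<gamma> E \<phi> \<and> s \<notin> sem \<gamma> E \<phi>"
  shows "\<exists>\<phi> \<in> hml_check_set. u \<in> sem \<gamma> E \<phi> \<and> S \<inter> sem \<gamma> E \<phi> = {}"
  using assms
proof (induction S)
  case empty
  then show ?case by (intro bexI[of _ FTrue]) (auto intro: hml_check_set.intros)
next
  case (insert s S)
  then obtain \<phi> \<psi> where "\<phi> \<in> hml_check_set" "u \<in> sem \<gamma> E \<phi>" "S \<inter> sem \<gamma> E \<phi> = {}"
    and "\<psi> \<in> hml_check_set" "u \<in> sem \<gamma> E \<psi>" "s \<notin> sem \<gamma> E \<psi>"
    by (metis insertCI)
  then show ?case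
    by (intro bexI[of _ "Conj \<phi> \<psi>"]) (auto intro: hml_check_set.intros)
qed

lemma image_finite_step:
  assumes "image_finite \<gamma> E P" and "step \<gamma> E (P, V) l (P', V')"
  shows "image_finite \<gamma> E P'"
proof -
  \<comment> \<open>Reachability does not thread valuations, so the given step can precede any path
    from \<open>P'\<close>.\<close>
  have "reachable \<gamma> E P P''" if "reachable \<gamma> E P' P''" for P''
    using converse_rtranclp_into_rtranclp[of "\<lambda>P P'. \<exists>l V V'. step \<gamma> E (P, V) l (P', V')"]
      assms(2) that unfolding reachable_def by blast
  then show ?thesis using assms(1) unfolding image_finite_def by blast
qed

lemma image_finite_successors:
  "image_finite \<gamma> E P \<Longrightarrow> finite {s. step \<gamma> E (P, V) l s}"
  unfolding image_finite_def reachable_def image_finite_state_def by blast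

text \<open>Quantifying over \<open>V\<close> leaves a relation on bare expressions, as a stateless
  bisimulation has to be.\<close>

definition hml_equivalent where
  "hml_equivalent \<gamma> E P Q \<longleftrightarrow>
    (\<forall>V. \<forall>\<phi> \<in> hml_check_set. (P, V) \<in> sem \<gamma> E \<phi> \<longleftrightarrow> (Q, V) \<in> sem \<gamma> E \<phi>)"

lemma hml_equivalent_sym: "hml_equivalent \<gamma> E P Q \<Longrightarrow> hml_equivalent \<gamma> E Q P"
  unfolding hml_equivalent_def by blast

lemma not_hml_equivalentD:
  fixes P Q :: "('a, 'v::finite, 'd, 'x) proc"
  assumes "\<not> hml_equivalent \<gamma> E P Q"
  shows "\<exists>\<phi> \<in> hml_check_set. \<forall>V. (P, V) \<in> sem \<gamma> E \<phi> \<and> (Q, V) \<notin> sem \<gamma> E \<phi>"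
proof -
  obtain W \<phi> where "\<phi> \<in> hml_check_set" "(P, W) \<in> sem \<gamma> E \<phi> \<longleftrightarrow> (Q, W) \<notin> sem \<gamma> E \<phi>"
    using assms unfolding hml_equivalent_def by blast
  \<comment> \<open>\<open>\<chi>\<close> is \<open>\<phi>\<close> or its negation, whichever holds
    on the side of \<open>P\<close>.\<close>
  then obtain \<chi> where "\<chi> \<in> hml_check_set" "(P, W) \<in> sem \<gamma> E \<chi>" "(Q, W) \<notin> sem \<gamma> E \<chi>"
    by (cases "(P, W) \<in> sem \<gamma> E \<phi>") (auto dest: hml_check_set.intros(4))
  then show ?thesis using ex_set_valuation_formula[of \<chi> \<gamma> E W] by blast
qed

text \<open>Hennessy-Milner argument: if no successor of \<open>(Q, V)\<close> matched, one formula
  would hold at \<open>(P', V')\<close> and fail at all of them, and the diamond over it would tell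
  \<open>P\<close> from \<open>Q\<close> at \<open>V\<close>.\<close>

lemma hml_equivalent_step:
  fixes P Q :: "('a, 'v::finite, 'd, 'x) proc"
  assumes equiv: "hml_equivalent \<gamma> E P Q" and fin: "image_finite \<gamma> E Q"
    and P_step: "step \<gamma> E (P, V) l (P', V')"
  shows "\<exists>Q'. step \<gamma> E (Q, V) l (Q', V') \<and> hml_equivalent \<gamma> E P' Q'"
proof (rule ccontr)
  assume contra: "\<not> ?thesis"
  have "\<exists>\<phi> \<in> hml_check_set. (P', V') \<in> sem \<gamma> E \<phi> \<and> s \<notin> sem \<gamma> E \<phi>"
    if Q_step: "s \<in> {s. step \<gamma> E (Q, V) l s}" for s
  proof -
    obtain Q' W where s: "s = (Q', W)" by (cases s)
    show ?thesis
    proof (cases "W = V'")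
      case True
      \<comment> \<open>The inequivalence may be witnessed at some other valuation;
        \<open>not_hml_equivalentD\<close> turns it into a separation at \<open>V'\<close>.\<close>
      then have "\<not> hml_equivalent \<gamma> E P' Q'" using contra Q_step s by blast
      then show ?thesis using not_hml_equivalentD s by blast
    next
      case False
      then obtain v where "W v \<noteq> V' v" by blast
      then show ?thesis
        using s by (intro bexI[of _ "Check v (V' v)"]) (auto intro: hml_check_set.intros)
    qed
  qed
  then obtain \<phi> where \<phi>: "\<phi> \<in> hml_check_set" "(P', V') \<in> sem \<gamma> E \<phi>"
    and disj: "{s. step \<gamma> E (Q, V) l s} \<inter> sem \<gamma> E \<phi> = {}"
    using ex_separating_conjunction[OF image_finite_successors[OF fin]] by meson
  have "Dia {l} \<phi> \<in> hml_check_set" using \<phi>(1) by (auto intro: hml_check_set.intros)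
  moreover have "(P, V) \<in> sem \<gamma> E (Dia {l} \<phi>)" using P_step \<phi>(2) by auto
  ultimately have "(Q, V) \<in> sem \<gamma> E (Dia {l} \<phi>)"
    using equiv unfolding hml_equivalent_def by blast
  then show False using disj by auto
qed

text \<open>Image-finiteness of both sides is part of the relation because either side may have to
  answer a step; it passes to successors. Symmetry of the equivalence gives the second transfer
  condition from the first.\<close>

lemma stateless_bisimulation_hml_equivalent:
  fixes E :: "('a, 'v::finite, 'd, 'x) spec"
  shows "stateless_bisimulation \<gamma> E
    {(P, Q). image_finite \<gamma> E P \<and> image_finite \<gamma> E Q \<and> hml_equivalent \<gamma> E P Q}"
  unfolding stateless_bisimulation_def
  by (simp, meson hml_equivalent_step hml_equivalent_sym image_finite_step)

theorem theorem11:
  fixes \<gamma> :: "'a \<Rightarrow> 'a \<Rightarrow> 'a option"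
    and E :: "('a, 'v::finite, 'd, 'x) spec"
    and P Q :: "('a, 'v, 'd, 'x) proc"
  assumes "comm_function \<gamma>"
    and "guarded_spec E"
    and "image_finite \<gamma> E P"
    and "image_finite \<gamma> E Q"
  shows "stateless_bisimilar \<gamma> E P Q \<longleftrightarrow>
    (\<forall>V. \<forall>\<phi> \<in> hml_check_set. (P, V) \<in> sem \<gamma> E \<phi> \<longleftrightarrow> (Q, V) \<in> sem \<gamma> E \<phi>)"
proof
  assume "stateless_bisimilar \<gamma> E P Q"
  then show "\<forall>V. \<forall>\<phi> \<in> hml_check_set. (P, V) \<in> sem \<gamma> E \<phi> \<longleftrightarrow> (Q, V) \<in> sem \<gamma> E \<phi>"
    unfolding stateless_bisimilar_def using sem_stateless_bisimulation by blast
next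
  assume "\<forall>V. \<forall>\<phi> \<in> hml_check_set. (P, V) \<in> sem \<gamma> E \<phi> \<longleftrightarrow> (Q, V) \<in> sem \<gamma> E \<phi>"
  then show "stateless_bisimilar \<gamma> E P Q"
    using assms(3,4) stateless_bisimulation_hml_equivalent[of \<gamma> E]
    unfolding stateless_bisimilar_def hml_equivalent_def by blast
qed

end
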